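(* Let $U=\{u_n\}_{n\ge1}$ be an increasing sequence (finite or infinite) of positive even integers and $V=\{v_n\}_{n\ge1}$ an increasing sequence (finite or infinite) of positive odd integers, with counting functions $U(y)=\#\{n:u_n\le y\}$ and $V(y)=\#\{n:v_n\le y\}$. For a positive odd integer $x$, let $h(x)$ be the number of solutions of $x=u+v$ with $u\in U$, $v\in V$. Then for every odd $x\ge3$, $$h(x)=\sum_{v\in V,\ v\le (x+1)/2}U(x-v)+\sum_{u\in U,\ u\le (x+1)/2}V(x-u)-U\!\left(\tfrac{x+1}{2}\right)V\!\left(\tfrac{x+1}{2}\right)-h(x-2)-h(x-4)-\dots-h(1).$$ *)

theory Defs
  imports Main "HOL-Library.Extended_Nat"
begin

(* A finite or infinite sequence is a function u together with its length N :: enat;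
   only the values of u on the index set below matter. N = 0 is the empty sequence. *)
definition seq_indices :: "enat \<Rightarrow> nat set" where
  "seq_indices N = {n. 1 \<le> n \<and> enat n \<le> N}"

definition seq_terms :: "enat \<Rightarrow> (nat \<Rightarrow> nat) \<Rightarrow> nat set" where
  "seq_terms N u = u ` seq_indices N"

definition counting :: "enat \<Rightarrow> (nat \<Rightarrow> nat) \<Rightarrow> nat \<Rightarrow> nat" where
  "counting N u y = card {n \<in> seq_indices N. u n \<le> y}"

definition num_reps :: "nat set \<Rightarrow> nat set \<Rightarrow> nat \<Rightarrow> nat" where
  "num_reps U V x = card {(a, b). a \<in> U \<and> b \<in> V \<and> x = a + b}"

end

theory Submission
  imports Defs
begin

text \<open>
  The representations of the odd numbers up to $x$ are together the pairs $(u, v)$ with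
  $u + v \<le> x$. With $m = (x + 1) / 2$, every such pair has $v \<le> m$ or $u \<le> m$, and
  inclusion-exclusion applies. The overlap consists of all pairs with $u, v \<le> m$, because
  $u + v \<le> 2m = x + 1$ and $u + v$ is odd.
\<close>

text \<open>Strict monotonicity makes \<open>u\<close> injective, so counting indices agrees with
  counting values. From here on only the sets of terms matter, whether the sequences are finite or
  infinite.\<close>

lemma counting_eq_card_terms:
  assumes "strict_mono_on (seq_indices N) u"
  shows "counting N u y = card {a \<in> seq_terms N u. a \<le> y}"
proof -
  have "inj_on u {n \<in> seq_indices N. u n \<le> y}"
    using strict_mono_on_imp_inj_on[OF assms] by (rule inj_on_subset) auto
  moreover have "{a \<in> seq_terms N u. a \<le> y} = u ` {n \<in> seq_indices N. u n \<le> y}"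
    by (auto simp: seq_terms_def)
  ultimately show ?thesis
    by (simp add: counting_def card_image)
qed

text \<open>Pairs with different sums are different, so the solution sets for distinct
  \<open>k\<close> are disjoint. Each is finite because both summands are at most
  \<open>k\<close>.\<close>

lemma sum_num_reps:
  assumes "finite K"
  shows "(\<Sum>k\<in>K. num_reps U V k) = card {(a, b). a \<in> U \<and> b \<in> V \<and> a + b \<in> K}"
proof -
  let ?R = "\<lambda>k. {(a, b). a \<in> U \<and> b \<in> V \<and> k = a + b}"
  have "finite (?R k)" for k :: nat
    by (rule finite_subset[of _ "{..k} \<times> {..k}"]) auto
  then have "card (\<Union>k\<in>K. ?R k) = (\<Sum>k\<in>K. card (?R k))"
    using assms by (intro card_UN_disjoint) auto
  moreover have "(\<Union>k\<in>K. ?R k) = {(a, b). a \<in> U \<and> b \<in> V \<and> a + b \<in> K}"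
    by auto
  ultimately show ?thesis
    by (simp add: num_reps_def)
qed

text \<open>Fibre the pairs over the first coordinate. The bound \<open>m \<le> x\<close> keeps
  \<open>x - a\<close> from being truncated, so \<open>b \<le> x - a\<close> really means
  \<open>a + b \<le> x\<close>.\<close>

lemma card_pairs_add_le:
  fixes A B :: "nat set"
  assumes "m \<le> x"
  shows "card {(a, b). a \<in> A \<and> b \<in> B \<and> a \<le> m \<and> a + b \<le> x} =
    (\<Sum>a\<in>{a \<in> A. a \<le> m}. card {b \<in> B. b \<le> x - a})"
proof -
  have "{(a, b). a \<in> A \<and> b \<in> B \<and> a \<le> m \<and> a + b \<le> x} =
      (SIGMA a:{a \<in> A. a \<le> m}. {b \<in> B. b \<le> x - a})"
    using assms by auto
  then show ?thesis
    by simp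
qed

lemma card_pairs_add_le_swap:
  fixes A B :: "nat set"
  assumes "m \<le> x"
  shows "card {(a, b). a \<in> A \<and> b \<in> B \<and> b \<le> m \<and> a + b \<le> x} =
    (\<Sum>b\<in>{b \<in> B. b \<le> m}. card {a \<in> A. a \<le> x - b})"
proof -
  have "{(a, b). a \<in> A \<and> b \<in> B \<and> b \<le> m \<and> a + b \<le> x} =
      prod.swap ` {(b, a). b \<in> B \<and> a \<in> A \<and> b \<le> m \<and> b + a \<le> x}"
    by (auto simp: image_iff add.commute)
  then show ?thesis
    using card_pairs_add_le[OF assms, of B A] by (simp add: card_image)
qed

theorem theorem3:
  fixes M N :: enat and u v :: "nat \<Rightarrow> nat" and U V :: "nat set" and x :: nat
  assumes u_incr: "strict_mono_on (seq_indices M) u"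
    and u_even: "\<forall>n \<in> seq_indices M. u n > 0 \<and> even (u n)"
    and v_incr: "strict_mono_on (seq_indices N) v"
    and v_odd: "\<forall>n \<in> seq_indices N. v n > 0 \<and> odd (v n)"
    and U: "U = seq_terms M u"
    and V: "V = seq_terms N v"
    and x: "odd x" "x \<ge> 3"
  shows "int (num_reps U V x) =
      (\<Sum>b \<in> {b \<in> V. b \<le> (x + 1) div 2}. int (counting M u (x - b)))
    + (\<Sum>a \<in> {a \<in> U. a \<le> (x + 1) div 2}. int (counting N v (x - a)))
    - int (counting M u ((x + 1) div 2)) * int (counting N v ((x + 1) div 2))
    - (\<Sum>k \<in> {k. odd k \<and> k < x}. int (num_reps U V k))"
proof -
  define m where "m = (x + 1) div 2"
  have m: "m \<le> x" "x + 1 = 2 * m"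
    using x by (auto simp: m_def)
  have even_U: "even a" if "a \<in> U" for a
    using that u_even by (auto simp: U seq_terms_def)
  have odd_V: "odd b" if "b \<in> V" for b
    using that v_odd by (auto simp: V seq_terms_def)
  have cU: "counting M u y = card {a \<in> U. a \<le> y}" for y
    unfolding U by (rule counting_eq_card_terms[OF u_incr])
  have cV: "counting N v y = card {b \<in> V. b \<le> y}" for y
    unfolding V by (rule counting_eq_card_terms[OF v_incr])
  define P where "P = {(a, b). a \<in> U \<and> b \<in> V \<and> b \<le> m \<and> a + b \<le> x}"
  define Q where "Q = {(a, b). a \<in> U \<and> b \<in> V \<and> a \<le> m \<and> a + b \<le> x}"
  have fin: "finite P" "finite Q"
    by (rule finite_subset[of _ "{..x} \<times> {..x}"]; auto simp: P_def Q_def)+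
  \<comment> \<open>The subtracted terms h(x-2), ..., h(1) are moved to the side of h(x), which
    leaves a single sum over all odd numbers up to \<open>x\<close>.\<close>
  have "{k. odd k \<and> k \<le> x} = insert x {k. odd k \<and> k < x}"
    using x by auto
  then have "num_reps U V x + (\<Sum>k\<in>{k. odd k \<and> k < x}. num_reps U V k) =
      (\<Sum>k\<in>{k. odd k \<and> k \<le> x}. num_reps U V k)"
    by simp
  also have "\<dots> = card {(a, b). a \<in> U \<and> b \<in> V \<and> a + b \<in> {k. odd k \<and> k \<le> x}}"
    by (rule sum_num_reps) simp
  \<comment> \<open>Oddness of \<open>a + b\<close> is automatic from the parities of the terms. If
    both terms exceeded \<open>m\<close>, their sum would be at least \<open>2 * m + 2\<close>,
    which is larger than \<open>x\<close>.\<close>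
  also have "{(a, b). a \<in> U \<and> b \<in> V \<and> a + b \<in> {k. odd k \<and> k \<le> x}} = P \<union> Q"
    using even_U odd_V m by (auto simp: P_def Q_def)
  finally have reps: "num_reps U V x + (\<Sum>k\<in>{k. odd k \<and> k < x}. num_reps U V k) = card (P \<union> Q)" .
  have "a + b \<le> x" if "a \<in> U" "b \<in> V" "a \<le> m" "b \<le> m" for a b
  proof -
    \<comment> \<open>Among pairs bounded by \<open>m\<close>, only \<open>a = b = m\<close> reaches
      the sum \<open>2 * m = x + 1\<close>; parity excludes it.\<close>
    have "a \<noteq> b"
      using even_U odd_V that by blast
    then show ?thesis
      using that m by linarith
  qed
  then have "P \<inter> Q = {a \<in> U. a \<le> m} \<times> {b \<in> V. b \<le> m}"
    by (auto simp: P_def Q_def)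
  then have "card (P \<inter> Q) = counting M u m * counting N v m"
    by (simp add: cU cV card_cartesian_product)
  moreover have "card P = (\<Sum>b\<in>{b \<in> V. b \<le> m}. counting M u (x - b))"
    unfolding P_def cU by (rule card_pairs_add_le_swap[OF m(1)])
  moreover have "card Q = (\<Sum>a\<in>{a \<in> U. a \<le> m}. counting N v (x - a))"
    unfolding Q_def cV by (rule card_pairs_add_le[OF m(1)])
  \<comment> \<open>Inclusion-exclusion is kept in additive form over the naturals; subtraction
    appears only after the passage to the integers.\<close>
  ultimately have "(\<Sum>b\<in>{b \<in> V. b \<le> m}. counting M u (x - b)) +
      (\<Sum>a\<in>{a \<in> U. a \<le> m}. counting N v (x - a)) =
      num_reps U V x + (\<Sum>k\<in>{k. odd k \<and> k < x}. num_reps U V k) +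
      counting M u m * counting N v m"
    using card_Un_Int[OF fin] reps by simp
  from arg_cong[OF this, of int] show ?thesis
    by (simp add: m_def)
qed

end
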